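(* Let $E$ be a finite set, $r:2^E\to\mathbb{Z}$ any function, $R$ a commutative ring with $1$, and $m_1,m_2:2^E\to R$ two functions; let $m_1m_2$ denote their pointwise product. Let $t,s$ and $u_e,v_e$ ($e\in E$) be indeterminates. Then, in $R[t^{\pm1},s^{\pm1},u_e,v_e : e\in E]$, $$\mathbf{Z}_{(E,r,m_1m_2)}\bigl(ts,\ (u_ev_e)_{e\in E}\bigr)=\sum_{A\subseteq E} s^{-r(A)}\Bigl(\prod_{e\in A}(-v_e)\Bigr)\,\mathbf{Z}_{(E,r,m_1)|A}\bigl(t,(-u_e)_{e\in A}\bigr)\,\mathbf{Z}_{(E,r,m_2)/A}\bigl(s,(v_e)_{e\in E\setminus A}\bigr).$$
   Context: A ranked set with multiplicity (rsm) is a triple $\mathcal{M}=(E,r,m)$ with $E$ a finite set, $r:2^E\to\mathbb{Z}$ an arbitrary function ($r(\emptyset)$ may be nonzero) and $m:2^E\to R$ an arbitrary function. Its multivariate Tutte polynomial is $\mathbf{Z}_{\mathcal{M}}(q,(v_e)_{e\in E})=\sum_{A\subseteq E} m(A)\,q^{-r(A)}\prod_{e\in A}v_e$ (empty product $=1$). For $A\subseteq E$, the restriction $\mathcal{M}|A$ is the rsm $(A, r|_{2^A}, m|_{2^A})$, and the contraction $\mathcal{M}/A$ is the rsm $(E\setminus A, r', m')$ with $r'(B)=r(B\cup A)-r(A)$ and $m'(B)=m(B\cup A)$ for $B\subseteq E\setminus A$. *)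

theory Defs
  imports "HOL-Library.Poly_Mapping" "HOL-Library.Product_Plus" "HOL-Library.FuncSet"
begin

text \<open>
  Ranked sets with multiplicity. Rank and multiplicity are total functions on \<^typ>\<open>'e set\<close>,
  but only their values on subsets of the ground set matter; finiteness of the ground set is
  stated separately.
\<close>

datatype ('e, 'r) rsm =
  RSM (ground: "'e set") (rank: "'e set \<Rightarrow> int") (mlt: "'e set \<Rightarrow> 'r")

definition rsm_restrict :: "('e, 'r) rsm \<Rightarrow> 'e set \<Rightarrow> ('e, 'r) rsm" where
  "rsm_restrict M A = RSM A (restrict (rank M) (Pow A)) (restrict (mlt M) (Pow A))"

definition rsm_contract :: "('e, 'r) rsm \<Rightarrow> 'e set \<Rightarrow> ('e, 'r) rsm" where
  "rsm_contract M A =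
     RSM (ground M - A)
       (\<lambda>B \<in> Pow (ground M - A). rank M (B \<union> A) - rank M A)
       (\<lambda>B \<in> Pow (ground M - A). mlt M (B \<union> A))"

text \<open>
  The ring $R[q^{\pm 1}, v_e]$ as a monoid algebra: the exponent \<open>(k, n)\<close> stands for the
  monomial $q^k \prod_e v_e^{n(e)}$.
\<close>

type_synonym ('e, 'r) qv_poly = "(int \<times> ('e \<Rightarrow>\<^sub>0 nat)) \<Rightarrow>\<^sub>0 'r"

definition tutte :: "('e, 'r::comm_ring_1) rsm \<Rightarrow> ('e, 'r) qv_poly" where
  "tutte M = (\<Sum>A \<in> Pow (ground M).
     Poly_Mapping.single (- rank M A, \<Sum>e\<in>A. Poly_Mapping.single e 1) (mlt M A))"

text \<open>Integer powers of a unit; for negative \<open>k\<close> this is meaningful only if \<open>x dvd 1\<close>.\<close>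

definition unit_powi :: "'a::comm_ring_1 \<Rightarrow> int \<Rightarrow> 'a" where
  "unit_powi x k = (if 0 \<le> k then x ^ nat k else (THE y. x * y = 1) ^ nat (- k))"

definition Const :: "'r::zero \<Rightarrow> ('k::zero \<Rightarrow>\<^sub>0 'r)" where
  "Const c = Poly_Mapping.single 0 c"

text \<open>
  Evaluation of a polynomial in $R[q^{\pm 1}, v_e]$ at a unit \<open>q\<close> and a family \<open>v\<close> of elements
  of a monoid algebra over the same coefficient ring.
\<close>

definition qv_subst ::
  "('e, 'r::comm_ring_1) qv_poly \<Rightarrow> ('k::comm_monoid_add \<Rightarrow>\<^sub>0 'r) \<Rightarrow> ('e \<Rightarrow> ('k \<Rightarrow>\<^sub>0 'r)) \<Rightarrow> ('k \<Rightarrow>\<^sub>0 'r)"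
where
  "qv_subst p q v = (\<Sum>k \<in> Poly_Mapping.keys p.
     Const (Poly_Mapping.lookup p k) * unit_powi q (fst k) *
     (\<Prod>e \<in> Poly_Mapping.keys (snd k). v e ^ Poly_Mapping.lookup (snd k) e))"

definition tutte_at ::
  "('e, 'r::comm_ring_1) rsm \<Rightarrow> ('k::comm_monoid_add \<Rightarrow>\<^sub>0 'r) \<Rightarrow> ('e \<Rightarrow> ('k \<Rightarrow>\<^sub>0 'r)) \<Rightarrow> ('k \<Rightarrow>\<^sub>0 'r)"
where
  "tutte_at M q v = qv_subst (tutte M) q v"

text \<open>
  The ring $R[t^{\pm 1}, s^{\pm 1}, u_e, v_e]$: the exponent \<open>(i, j, a, b)\<close> stands for
  $t^i s^j \prod_e u_e^{a(e)} v_e^{b(e)}$. There is one pair of indeterminates for each element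
  of the type \<^typ>\<open>'e\<close>; only those with index in the ground set occur in Tutte polynomials.
\<close>

type_synonym ('e, 'r) tsuv_poly =
  "(int \<times> int \<times> ('e \<Rightarrow>\<^sub>0 nat) \<times> ('e \<Rightarrow>\<^sub>0 nat)) \<Rightarrow>\<^sub>0 'r"

definition Var_t :: "('e, 'r::comm_ring_1) tsuv_poly" where
  "Var_t = Poly_Mapping.single (1, 0, 0, 0) 1"

definition Var_s :: "('e, 'r::comm_ring_1) tsuv_poly" where
  "Var_s = Poly_Mapping.single (0, 1, 0, 0) 1"

definition Var_u :: "'e \<Rightarrow> ('e, 'r::comm_ring_1) tsuv_poly" where
  "Var_u e = Poly_Mapping.single (0, 0, Poly_Mapping.single e 1, 0) 1"

definition Var_v :: "'e \<Rightarrow> ('e, 'r::comm_ring_1) tsuv_poly" where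
  "Var_v e = Poly_Mapping.single (0, 0, 0, Poly_Mapping.single e 1) 1"

lemma the_unit_inverse:
  fixes x y :: "'a::comm_ring_1"
  assumes xy: "x * y = 1"
  shows "(THE z. x * z = 1) = y"
proof (rule the_equality)
  show "x * y = 1" by (rule xy)
next
  fix z assume xz: "x * z = 1"
  have "z = (x * y) * z" by (simp add: xy)
  also have "\<dots> = y * (x * z)" by (simp only: ac_simps)
  finally show "z = y" by (simp add: xz)
qed

lemma unit_powi_Var_t: "unit_powi Var_t k = Poly_Mapping.single (k, 0, 0, 0) 1"
proof -
  have pow: "Poly_Mapping.single (i, 0, 0, 0) (1::'b) ^ n =
      (Poly_Mapping.single (int n * i, 0, 0, 0) 1 :: ('a, 'b) tsuv_poly)" for n :: nat and i :: int
    by (induction n)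
       (simp_all add: mult_single algebra_simps flip: single_one zero_prod_def)
  have inv: "Var_t * Poly_Mapping.single (-1, 0, 0, 0) 1 = (1 :: ('a, 'b) tsuv_poly)"
    by (simp add: Var_t_def mult_single flip: single_one zero_prod_def)
  have "(THE y. Var_t * y = (1 :: ('a, 'b) tsuv_poly)) = Poly_Mapping.single (-1, 0, 0, 0) 1"
    by (rule the_unit_inverse[OF inv])
  then show ?thesis
    by (simp add: unit_powi_def pow) (simp add: Var_t_def pow)
qed

lemma unit_powi_Var_s: "unit_powi Var_s k = Poly_Mapping.single (0, k, 0, 0) 1"
proof -
  have pow: "Poly_Mapping.single (0, i, 0, 0) (1::'b) ^ n =
      (Poly_Mapping.single (0, int n * i, 0, 0) 1 :: ('a, 'b) tsuv_poly)" for n :: nat and i :: int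
    by (induction n)
       (simp_all add: mult_single algebra_simps flip: single_one zero_prod_def)
  have inv: "Var_s * Poly_Mapping.single (0, -1, 0, 0) 1 = (1 :: ('a, 'b) tsuv_poly)"
    by (simp add: Var_s_def mult_single flip: single_one zero_prod_def)
  have "(THE y. Var_s * y = (1 :: ('a, 'b) tsuv_poly)) = Poly_Mapping.single (0, -1, 0, 0) 1"
    by (rule the_unit_inverse[OF inv])
  then show ?thesis
    by (simp add: unit_powi_def pow) (simp add: Var_s_def pow)
qed

lemma tutte_at_formula:
  fixes M :: "('e, 'r::comm_ring_1) rsm" and q :: "'k::comm_monoid_add \<Rightarrow>\<^sub>0 'r"
  assumes fin: "finite (ground M)"
  shows "tutte_at M q v =
    (\<Sum>A \<in> Pow (ground M). Const (mlt M A) * unit_powi q (- rank M A) * (\<Prod>e\<in>A. v e))"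
proof -
  define mon where "mon = (\<lambda>k :: int \<times> ('e \<Rightarrow>\<^sub>0 nat). unit_powi q (fst k) *
     (\<Prod>e \<in> Poly_Mapping.keys (snd k). v e ^ Poly_Mapping.lookup (snd k) e))"
  define F where "F = (\<lambda>A. Poly_Mapping.single
     (- rank M A, \<Sum>e\<in>A. Poly_Mapping.single e (1::nat)) (mlt M A))"
  have sub: "qv_subst p q v = (\<Sum>k\<in>K. Const (Poly_Mapping.lookup p k) * mon k)"
    if "finite K" "Poly_Mapping.keys p \<subseteq> K" for p K
    unfolding qv_subst_def mon_def mult.assoc using that
    by (intro sum.mono_neutral_left) (auto simp: Const_def in_keys_iff)
  have add: "qv_subst (p + p') q v = qv_subst p q v + qv_subst p' q v" for p p'
  proof -
    let ?K = "Poly_Mapping.keys p \<union> Poly_Mapping.keys p'"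
    have "Poly_Mapping.keys (p + p') \<subseteq> ?K" by (rule Poly_Mapping.keys_add)
    then show ?thesis
      by (simp add: sub[of ?K] lookup_add Const_def single_add distrib_right sum.distrib)
  qed
  have "qv_subst (\<Sum>A\<in>X. F A) q v = (\<Sum>A\<in>X. qv_subst (F A) q v)" if "finite X" for X
    using that by (induction X) (simp_all add: add, simp add: qv_subst_def)
  moreover have "qv_subst (F A) q v =
      Const (mlt M A) * unit_powi q (- rank M A) * (\<Prod>e\<in>A. v e)" if "A \<subseteq> ground M" for A
  proof -
    have fA: "finite A" using that fin finite_subset by blast
    have lk: "Poly_Mapping.lookup (\<Sum>e\<in>A. Poly_Mapping.single e (1::nat)) x = (if x \<in> A then 1 else 0)" for x
      using fA by (simp add: lookup_sum lookup_single when_def)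
    have "Poly_Mapping.keys (\<Sum>e\<in>A. Poly_Mapping.single e (1::nat)) = A"
      by (rule set_eqI) (simp only: in_keys_iff lk, simp)
    then have "mon (- rank M A, \<Sum>e\<in>A. Poly_Mapping.single e (1::nat)) =
        unit_powi q (- rank M A) * (\<Prod>e\<in>A. v e)"
      by (simp add: mon_def lk del: One_nat_def)
    then show ?thesis
      by (subst sub[of "{(- rank M A, \<Sum>e\<in>A. Poly_Mapping.single e (1::nat))}"])
         (auto simp: F_def mult.assoc split: if_splits)
  qed
  ultimately show ?thesis
    using fin by (simp add: tutte_at_def tutte_def F_def)
qed

end

theory Submission
  imports Defs
begin

text \<open>
  Writing each subset of the contraction's ground set as \<open>D - A\<close> with \<open>A \<subseteq> D \<subseteq> E\<close>, the powers of
  \<open>s\<close> telescope to $s^{-r(D)}$ and the right-hand side becomes a sum over chains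
  \<open>B \<subseteq> A \<subseteq> D \<subseteq> E\<close> in which \<open>A\<close> only contributes the sign $(-1)^{|A|}$. The alternating sum over
  the interval between \<open>B\<close> and \<open>D\<close> vanishes unless \<open>B = D\<close>, and the diagonal terms are the
  left-hand side.
\<close>

text \<open>Toggling a fixed element \<open>x\<close> of \<open>D - B\<close> is a sign-reversing
  involution on the interval, so everything cancels as soon as such an \<open>x\<close>
  exists.\<close>

lemma sum_alternating_interval:
  assumes "finite D" "B \<subseteq> D"
  shows "(\<Sum>A | B \<subseteq> A \<and> A \<subseteq> D. (-1) ^ card A) =
    (if B = D then (-1) ^ card D else (0 :: 'a::comm_ring_1))"
proof (cases "B = D")
  case True
  then have "{A. B \<subseteq> A \<and> A \<subseteq> D} = {D}" by auto
  with True show ?thesis by simp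
next
  case False
  with assms(2) obtain x where x: "x \<in> D" "x \<notin> B" by blast
  let ?I = "{A. B \<subseteq> A \<and> A \<subseteq> D - {x}}"
  have finI: "finite ?I"
    by (rule finite_subset[of _ "Pow D"]) (use assms(1) in auto)
  \<comment> \<open>The members of \<open>?I\<close> avoid \<open>x\<close>, which makes inserting
    \<open>x\<close> injective and raises each cardinality by exactly one.\<close>
  have inj: "inj_on (insert x) ?I"
    by (rule inj_on_subset[of _ "{A. x \<notin> A}"]) (auto intro!: inj_onI)
  have "{A. B \<subseteq> A \<and> A \<subseteq> D} = ?I \<union> insert x ` ?I"
  proof (intro equalityI subsetI)
    fix A assume A: "A \<in> {A. B \<subseteq> A \<and> A \<subseteq> D}"
    show "A \<in> ?I \<union> insert x ` ?I"
    proof (cases "x \<in> A")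
      case True
      then have "A = insert x (A - {x})" by blast
      moreover have "A - {x} \<in> ?I" using A x by blast
      ultimately show ?thesis by blast
    qed (use A in blast)
  qed (use x in auto)
  then have "(\<Sum>A | B \<subseteq> A \<and> A \<subseteq> D. (-1) ^ card A) =
      (\<Sum>A\<in>?I. (-1) ^ card A) + (\<Sum>A\<in>insert x ` ?I. (-1 :: 'a) ^ card A)"
    using finI by (simp only:) (rule sum.union_disjoint, auto)
  also have "(\<Sum>A\<in>insert x ` ?I. (-1 :: 'a) ^ card A) = (\<Sum>A\<in>?I. - ((-1) ^ card A))"
  proof (unfold sum.reindex[OF inj], rule sum.cong)
    fix A assume A: "A \<in> ?I"
    then have "finite A" using assms(1) by (auto intro: finite_subset)
    with A show "((\<lambda>A. (-1 :: 'a) ^ card A) \<circ> insert x) A = - ((-1) ^ card A)"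
      by (subst comp_apply, subst card_insert_disjoint) auto
  qed simp
  finally show ?thesis using False by (simp add: sum_negf)
qed

lemma prod_uminus_card: "(\<Prod>x\<in>A. - f x) = (-1) ^ card A * (\<Prod>x\<in>A. f x :: 'a::comm_ring_1)"
  by (induction A rule: infinite_finite_induct) (simp_all add: algebra_simps)

lemma minus_one_power_mult_self: "(-1 :: 'a::comm_ring_1) ^ n * (-1) ^ n = 1"
  by (simp flip: power_mult_distrib)

text \<open>Negative exponents go through the unique inverse; given inverses \<open>x'\<close> and
  \<open>y'\<close>, the inverse of the product is \<open>x' * y'\<close>, so both signs of
  \<open>k\<close> reduce to ordinary powers.\<close>

lemma unit_powi_mult:
  fixes x y :: "'a::comm_ring_1"
  assumes "x * x' = 1" "y * y' = 1"
  shows "unit_powi (x * y) k = unit_powi x k * unit_powi y k"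
proof -
  have "(x * y) * (x' * y') = (x * x') * (y * y')" by (simp only: ac_simps)
  then have "(x * y) * (x' * y') = 1" by (simp add: assms)
  then show ?thesis
    using assms by (simp add: unit_powi_def the_unit_inverse power_mult_distrib)
qed

lemma unit_powi_Var_t_mult_Var_s:
  "unit_powi (Var_t * Var_s :: ('e, 'r::comm_ring_1) tsuv_poly) k =
     unit_powi Var_t k * unit_powi Var_s k"
proof (rule unit_powi_mult)
  show "Var_t * Poly_Mapping.single (-1, 0, 0, 0) 1 = (1 :: ('e, 'r) tsuv_poly)"
    by (simp add: Var_t_def mult_single flip: single_one zero_prod_def)
  show "Var_s * Poly_Mapping.single (0, -1, 0, 0) 1 = (1 :: ('e, 'r) tsuv_poly)"
    by (simp add: Var_s_def mult_single flip: single_one zero_prod_def)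
qed

lemma unit_powi_Var_s_add:
  "unit_powi Var_s (i + j) = unit_powi Var_s i * (unit_powi Var_s j :: ('e, 'r::comm_ring_1) tsuv_poly)"
  by (simp add: unit_powi_Var_s mult_single)

lemma Const_mult:
  "Const (a * b) = (Const a * Const b :: 'k::comm_monoid_add \<Rightarrow>\<^sub>0 'r::comm_ring_1)"
  by (simp add: Const_def mult_single)

lemma tutte_at_restrict:
  assumes "finite A"
  shows "tutte_at (rsm_restrict (RSM E r m) A) q v =
    (\<Sum>B\<in>Pow A. Const (m B) * unit_powi q (- r B) * (\<Prod>e\<in>B. v e))"
  using assms by (subst tutte_at_formula) (simp_all add: rsm_restrict_def)

text \<open>Indexing by \<open>D = C \<union> A\<close> instead of
  \<open>C \<subseteq> E - A\<close> evaluates \<open>r\<close> and \<open>m\<close> at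
  \<open>D\<close> itself, which allows the outer sum over \<open>A\<close> to be exchanged with the
  one over \<open>D\<close>.\<close>

lemma tutte_at_contract:
  assumes "finite E" "A \<subseteq> E"
  shows "tutte_at (rsm_contract (RSM E r m) A) q v =
    (\<Sum>D | A \<subseteq> D \<and> D \<subseteq> E. Const (m D) * unit_powi q (r A - r D) * (\<Prod>e\<in>D - A. v e))"
proof -
  have "tutte_at (rsm_contract (RSM E r m) A) q v =
    (\<Sum>C\<in>Pow (E - A). Const (m (C \<union> A)) * unit_powi q (r A - r (C \<union> A)) * (\<Prod>e\<in>C. v e))"
    using assms(1) by (subst tutte_at_formula) (simp_all add: rsm_contract_def)
  also have "\<dots> =
    (\<Sum>D | A \<subseteq> D \<and> D \<subseteq> E. Const (m D) * unit_powi q (r A - r D) * (\<Prod>e\<in>D - A. v e))"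
  proof (rule sum.reindex_bij_witness[of _ "\<lambda>D. D - A" "\<lambda>C. C \<union> A"])
    fix C assume "C \<in> Pow (E - A)"
    then have "C \<union> A - A = C" by blast
    then show "C \<union> A - A = C"
      "Const (m (C \<union> A)) * unit_powi q (r A - r (C \<union> A)) * (\<Prod>e\<in>C \<union> A - A. v e) =
       Const (m (C \<union> A)) * unit_powi q (r A - r (C \<union> A)) * (\<Prod>e\<in>C. v e)"
      by simp_all
  qed (use assms(2) in auto)
  finally show ?thesis .
qed

theorem theorem3p10:
  fixes E :: "'e set" and r :: "'e set \<Rightarrow> int"
    and m1 m2 :: "'e set \<Rightarrow> 'r::comm_ring_1"
  assumes "finite E"
  shows "(tutte_at (RSM E r (\<lambda>A. m1 A * m2 A)) (Var_t * Var_s) (\<lambda>e. Var_u e * Var_v e)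
           :: ('e, 'r) tsuv_poly) =
    (\<Sum>A \<in> Pow E. unit_powi Var_s (- r A) * (\<Prod>e\<in>A. - Var_v e) *
       tutte_at (rsm_restrict (RSM E r m1) A) Var_t (\<lambda>e. - Var_u e) *
       tutte_at (rsm_contract (RSM E r m2) A) Var_s Var_v)"
proof -
  \<comment> \<open>\<open>G B D\<close> collects every factor of a chain term that does not depend
    on the middle set \<open>A\<close>; its sign comes from the arguments \<open>- Var_u e\<close>
    with \<open>e \<in> B\<close>.\<close>
  define G :: "'e set \<Rightarrow> 'e set \<Rightarrow> ('e, 'r) tsuv_poly" where
    "G B D = Const (m1 B) * Const (m2 D) * unit_powi Var_t (- r B) * unit_powi Var_s (- r D) *
       (-1) ^ card B * (\<Prod>e\<in>B. Var_u e) * (\<Prod>e\<in>D. Var_v e)" for B D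
  have fin: "finite A" if "A \<subseteq> E" for A
    using that assms by (rule finite_subset)
  have term_eq: "unit_powi Var_s (- r A) * (\<Prod>e\<in>A. - Var_v e) *
      (Const (m1 B) * unit_powi Var_t (- r B) * (\<Prod>e\<in>B. - Var_u e)) *
      (Const (m2 D) * unit_powi Var_s (r A - r D) * (\<Prod>e\<in>D - A. Var_v e)) =
      (-1) ^ card A * G B D" if "A \<subseteq> D" "D \<subseteq> E" for A B D
  proof -
    \<comment> \<open>The prefactor \<open>- r A\<close> cancels the shift by \<open>r A\<close> in
      the contracted rank.\<close>
    have s: "unit_powi Var_s (- r D) =
        unit_powi Var_s (- r A) * (unit_powi Var_s (r A - r D) :: ('e, 'r) tsuv_poly)"
      by (simp flip: unit_powi_Var_s_add)
    have v: "(\<Prod>e\<in>D. Var_v e) =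
        (\<Prod>e\<in>A. Var_v e) * (\<Prod>e\<in>D - A. Var_v e :: ('e, 'r) tsuv_poly)"
      using prod.subset_diff[OF that(1) fin[OF that(2)]] by (simp add: mult.commute)
    show ?thesis unfolding G_def s v prod_uminus_card by (simp only: ac_simps)
  qed
  have "(\<Sum>A \<in> Pow E. unit_powi Var_s (- r A) * (\<Prod>e\<in>A. - Var_v e) *
       tutte_at (rsm_restrict (RSM E r m1) A) Var_t (\<lambda>e. - Var_u e) *
       tutte_at (rsm_contract (RSM E r m2) A) Var_s Var_v) =
    (\<Sum>A\<in>Pow E. \<Sum>D | D \<in> Pow E \<and> A \<subseteq> D. \<Sum>B\<in>Pow A. (-1) ^ card A * G B D)"
  proof (rule sum.cong)
    fix A assume "A \<in> Pow E"
    then have A: "A \<subseteq> E" by simp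
    have set: "{D. D \<in> Pow E \<and> A \<subseteq> D} = {D. A \<subseteq> D \<and> D \<subseteq> E}" by auto
    show "unit_powi Var_s (- r A) * (\<Prod>e\<in>A. - Var_v e) *
       tutte_at (rsm_restrict (RSM E r m1) A) Var_t (\<lambda>e. - Var_u e) *
       tutte_at (rsm_contract (RSM E r m2) A) Var_s Var_v =
       (\<Sum>D | D \<in> Pow E \<and> A \<subseteq> D. \<Sum>B\<in>Pow A. (-1) ^ card A * G B D)"
      unfolding set tutte_at_restrict[OF fin[OF A]] tutte_at_contract[OF assms A]
        sum_distrib_left sum_distrib_right
      by (intro sum.cong refl term_eq) auto
  qed simp
  also have "\<dots> = (\<Sum>D\<in>Pow E. \<Sum>A | A \<in> Pow E \<and> A \<subseteq> D. \<Sum>B\<in>Pow A. (-1) ^ card A * G B D)"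
    by (rule sum.swap_restrict) (use assms in auto)
  also have "\<dots> = (\<Sum>D\<in>Pow E. G D D * (-1) ^ card D)"
  proof (rule sum.cong)
    fix D assume "D \<in> Pow E"
    then have D: "D \<subseteq> E" by simp
    \<comment> \<open>The condition \<open>B \<in> Pow D\<close> follows from
      \<open>B \<subseteq> A \<subseteq> D\<close>; spelling it out gives both sums the range
      \<open>Pow D\<close>, as \<open>sum.swap_restrict\<close> expects.\<close>
    have "(\<Sum>A | A \<in> Pow E \<and> A \<subseteq> D. \<Sum>B\<in>Pow A. (-1) ^ card A * G B D) =
      (\<Sum>A\<in>Pow D. \<Sum>B | B \<in> Pow D \<and> B \<subseteq> A. (-1) ^ card A * G B D)"
      using D by (intro sum.cong) auto
    also have "\<dots> = (\<Sum>B\<in>Pow D. \<Sum>A | A \<in> Pow D \<and> B \<subseteq> A. (-1) ^ card A * G B D)"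
      by (rule sum.swap_restrict) (use fin[OF D] in auto)
    also have "\<dots> = (\<Sum>B\<in>Pow D. (\<Sum>A | B \<subseteq> A \<and> A \<subseteq> D. (-1) ^ card A) * G B D)"
      unfolding sum_distrib_right by (intro sum.cong) auto
    also have "\<dots> = (\<Sum>B\<in>Pow D. if B = D then G D D * (-1) ^ card D else 0)"
      by (intro sum.cong) (auto simp: sum_alternating_interval fin[OF D] mult.commute)
    also have "\<dots> = G D D * (-1) ^ card D"
      using fin[OF D] by simp
    finally show "(\<Sum>A | A \<in> Pow E \<and> A \<subseteq> D. \<Sum>B\<in>Pow A. (-1) ^ card A * G B D) =
      G D D * (-1) ^ card D" .
  qed simp
  also have "\<dots> = (\<Sum>D\<in>Pow E. Const (m1 D * m2 D) * unit_powi (Var_t * Var_s) (- r D) *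
      (\<Prod>e\<in>D. Var_u e * Var_v e))"
  proof (rule sum.cong)
    fix D
    \<comment> \<open>The sign inside \<open>G D D\<close> meets the one left by the alternating
      sum, and the two cancel.\<close>
    have "G D D * (-1) ^ card D = ((-1) ^ card D * (-1) ^ card D) *
      (Const (m1 D) * Const (m2 D) * (unit_powi Var_t (- r D) * unit_powi Var_s (- r D)) *
      ((\<Prod>e\<in>D. Var_u e) * (\<Prod>e\<in>D. Var_v e)))"
      unfolding G_def by (simp only: ac_simps)
    then show "G D D * (-1) ^ card D =
      Const (m1 D * m2 D) * unit_powi (Var_t * Var_s) (- r D) * (\<Prod>e\<in>D. Var_u e * Var_v e)"
      unfolding minus_one_power_mult_self Const_mult unit_powi_Var_t_mult_Var_s prod.distrib
      by simp
  qed simp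
  finally show ?thesis
    using assms by (simp add: tutte_at_formula)
qed

end
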